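(* The sequence $\{P(A_n,q)\}_{n\geqslant0}$ of Eulerian polynomials of type $A$ and the sequence $\{A_n(q)\}_{n\geqslant0}$ of classical Eulerian polynomials are each strongly $q$-log-convex.
   Context: The classical Eulerian polynomials $A_n(q)$ and the Eulerian polynomials $P(A_n,q)$ of type $A$ are indexed so that $P(A_n,q)=A_n(q)/q=\sum_{\pi\in S_n}q^{\mathrm{des}(\pi)}$ for $n\geqslant1$, where $\mathrm{des}(\pi)$ is the number of $i\in\{1,\dots,n-1\}$ with $\pi(i)>\pi(i+1)$, and $A_0(q)=P(A_0,q)=1$. Equivalently, as formal power series in $x$, $$\sum_{n\geqslant0}A_n(q)\frac{x^n}{n!}=\frac{1-q}{1-qe^{x(1-q)}},\qquad \sum_{n\geqslant0}P(A_n,q)\frac{x^n}{n!}=\frac{(1-q)e^{x(1-q)}}{1-qe^{x(1-q)}} .$$ For real polynomials $f(q),g(q)$, write $f(q)\geqslant_q g(q)$ if $f(q)-g(q)$ has only nonnegative coefficients as a polynomial in $q$. A sequence $\{f_n(q)\}_{n\geqslant0}$ of real polynomials is strongly $q$-log-convex if $f_{m-1}(q)f_{n+1}(q)\geqslant_q f_m(q)f_n(q)$ for all $n\geqslant m\geqslant 1$. *)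

theory Defs
  imports
    "HOL-Computational_Algebra.Polynomial"
    "HOL-Combinatorics.Permutations"
begin

definition des :: "nat \<Rightarrow> (nat \<Rightarrow> nat) \<Rightarrow> nat" where
  "des n \<pi> = card {i \<in> {1..<n}. \<pi> i > \<pi> (i + 1)}"

text \<open>
  The Eulerian polynomial of type A, \<open>P(A\<^sub>n, q)\<close>, with \<open>q\<close> the polynomial indeterminate.
  For \<open>n = 0\<close> the sum runs over the identity alone and gives the convention \<open>P(A\<^sub>0, q) = 1\<close>.
\<close>
definition eulerian_poly_type_A :: "nat \<Rightarrow> real poly" where
  "eulerian_poly_type_A n = (\<Sum>\<pi> | \<pi> permutes {1..n}. monom 1 (des n \<pi>))"

text \<open>
  The classical \<open>A\<^sub>n(q) = q P(A\<^sub>n, q)\<close> for \<open>n \<ge> 1\<close>; note the exception \<open>A\<^sub>0(q) = 1\<close>.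
\<close>
definition eulerian_poly :: "nat \<Rightarrow> real poly" where
  "eulerian_poly n = (if n = 0 then 1 else monom 1 1 * eulerian_poly_type_A n)"

definition q_ge :: "real poly \<Rightarrow> real poly \<Rightarrow> bool"  (infix \<open>\<ge>\<^sub>q\<close> 50) where
  "f \<ge>\<^sub>q g \<longleftrightarrow> (\<forall>k. coeff (f - g) k \<ge> 0)"

definition strongly_q_log_convex :: "(nat \<Rightarrow> real poly) \<Rightarrow> bool" where
  "strongly_q_log_convex f \<longleftrightarrow>
     (\<forall>m n. 1 \<le> m \<and> m \<le> n \<longrightarrow> f (m - 1) * f (n + 1) \<ge>\<^sub>q f m * f n)"

lemma eulerian_poly_type_A_0: "eulerian_poly_type_A 0 = 1"
  by (simp add: eulerian_poly_type_A_def des_def)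

end

theory Submission
  imports Defs "HOL-Combinatorics.Multiset_Permutations"
begin

text \<open>
  Write \<open>P\<^sub>n\<close> for the Eulerian polynomial of type A. The proof places the \<open>P\<^sub>n\<close> in the first column
  of an infinite triangle \<open>T\<^sub>n(k)\<close> of polynomials with \<open>T\<^sub>0 = (1, 0, 0, \<dots>)\<close> and
  \<open>T\<^sub>n\<^sub>+\<^sub>1(k) = T\<^sub>n(k-1) + s\<^sub>k T\<^sub>n(k) + t\<^sub>k\<^sub>+\<^sub>1 T\<^sub>n(k+1)\<close>, where \<open>s\<^sub>k = (k+1) + kq\<close> and
  \<open>t\<^sub>k = k\<^sup>2q\<close>. These are the coefficients of the Jacobi continued fraction of \<open>\<Sum> P\<^sub>n x\<^sup>n\<close>.

  The recurrence multiplies the row \<open>T\<^sub>n\<close> by a tridiagonal matrix with nonnegative coefficients. Its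
  only 2-by-2 minors that are not obviously nonnegative are \<open>s\<^sub>k s\<^sub>k\<^sub>+\<^sub>1 - t\<^sub>k\<^sub>+\<^sub>1\<close>, and here these have
  nonnegative coefficients as well. By the Cauchy-Binet formula, multiplying two rows by
  the matrix keeps their 2-by-2 minors nonnegative
  (\<open>row_minor_tridiag_step_nonneg\<close>). Starting from the rows \<open>T\<^sub>0\<close> and \<open>T\<^sub>d\<close>, whose minors are
  entries of \<open>T\<^sub>d\<close> or zero, one obtains that all minors of the rows \<open>T\<^sub>a\<close> and \<open>T\<^sub>a\<^sub>+\<^sub>d\<close> with increasing
  columns are nonnegative. For \<open>a = m - 1\<close> and \<open>a + d = n\<close>, one application of the recurrence
  in column 0 gives
  \<open>T\<^sub>m\<^sub>-\<^sub>1(0) T\<^sub>n\<^sub>+\<^sub>1(0) - T\<^sub>m(0) T\<^sub>n(0) = t\<^sub>1 (T\<^sub>m\<^sub>-\<^sub>1(0) T\<^sub>n(1) - T\<^sub>m\<^sub>-\<^sub>1(1) T\<^sub>n(0))\<close>, so the first column is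
  strongly \<open>q\<close>-log-convex (\<open>tableau_strongly_q_log_convex\<close>).

  That the first column is \<open>P\<^sub>n\<close> follows by comparing recurrences. Inserting the value \<open>n + 1\<close> into
  the word of a permutation of \<open>{1..n}\<close> yields
  \<open>P\<^sub>n\<^sub>+\<^sub>1 = (1 + nq) P\<^sub>n + q (1 - q) P\<^sub>n'\<close> (\<open>eulerian_poly_type_A_recurrence\<close>), and the triangle satisfies
  the same recurrence because the derivative of an entry is a combination of two entries of the
  same row (\<open>euler_tableau_pderiv\<close>).

  Since \<open>A\<^sub>n = q P\<^sub>n\<close> for \<open>n \<ge> 1\<close>, the result carries over to the classical polynomials when
  \<open>m \<ge> 2\<close>. The exceptional value \<open>A\<^sub>0 = 1\<close> leaves the case \<open>m = 1\<close>, which amounts to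
  \<open>P\<^sub>n\<^sub>+\<^sub>1 \<ge>\<^sub>q q P\<^sub>n\<close> and is read off from the insertion count.
\<close>

section \<open>Polynomials with nonnegative coefficients\<close>

lemma q_ge_0_iff: "f \<ge>\<^sub>q 0 \<longleftrightarrow> (\<forall>k. coeff f k \<ge> 0)"
  by (simp add: q_ge_def)

lemma q_ge_diff_iff: "f \<ge>\<^sub>q g \<longleftrightarrow> f - g \<ge>\<^sub>q 0"
  by (simp add: q_ge_def)

lemma q_ge_0_zero [simp]: "0 \<ge>\<^sub>q 0"
  by (simp add: q_ge_def)

lemma q_ge_0_add [intro]: "f \<ge>\<^sub>q 0 \<Longrightarrow> g \<ge>\<^sub>q 0 \<Longrightarrow> f + g \<ge>\<^sub>q 0"
  by (simp add: q_ge_0_iff)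

lemma q_ge_0_mult [intro]: "f \<ge>\<^sub>q 0 \<Longrightarrow> g \<ge>\<^sub>q 0 \<Longrightarrow> f * g \<ge>\<^sub>q 0"
  by (auto simp: q_ge_0_iff coeff_mult intro!: sum_nonneg)

lemma q_ge_0_sum: "(\<And>x. x \<in> S \<Longrightarrow> f x \<ge>\<^sub>q 0) \<Longrightarrow> (\<Sum>x\<in>S. f x) \<ge>\<^sub>q 0"
  by (auto simp: q_ge_0_iff coeff_sum intro!: sum_nonneg)

lemma q_ge_0_of_nat [simp]: "of_nat c \<ge>\<^sub>q 0"
  by (simp add: q_ge_0_iff of_nat_poly coeff_pCons split: nat.split)

lemma q_ge_0_monom [simp]: "monom 1 d \<ge>\<^sub>q 0"
  by (simp add: q_ge_0_iff)

section \<open>Log-convexity from tridiagonal recurrences\<close>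

text \<open>
  This is the product of the row vector \<open>u\<close> with the infinite tridiagonal matrix that has \<open>s\<close> on the
  diagonal, ones above it and \<open>t\<^sub>1, t\<^sub>2, \<dots>\<close> below it.
\<close>
definition tridiag_step ::
    "(nat \<Rightarrow> 'a::comm_ring_1) \<Rightarrow> (nat \<Rightarrow> 'a) \<Rightarrow> (nat \<Rightarrow> 'a) \<Rightarrow> nat \<Rightarrow> 'a" where
  "tridiag_step s t u k =
     (case k of 0 \<Rightarrow> 0 | Suc j \<Rightarrow> u j) + s k * u k + t (Suc k) * u (Suc k)"

definition row_minor :: "(nat \<Rightarrow> 'a::comm_ring_1) \<Rightarrow> (nat \<Rightarrow> 'a) \<Rightarrow> nat \<Rightarrow> nat \<Rightarrow> 'a" where
  "row_minor u v i j = u i * v j - u j * v i"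

text \<open>
  By bilinearity, a minor of the two new rows is a combination of nine minors of the old rows, with
  products of two matrix entries as weights. When the columns \<open>k\<close> and \<open>l\<close> are at least two apart,
  all nine are minors in weakly increasing columns. When they are adjacent, the minor in
  columns \<open>k + 1, k\<close> has the wrong sign, but it merges with the one in columns \<open>k, k + 1\<close>,
  and the joint weight is \<open>s\<^sub>k s\<^sub>k\<^sub>+\<^sub>1 - t\<^sub>k\<^sub>+\<^sub>1\<close>.
\<close>
lemma row_minor_tridiag_step_nonneg:
  assumes s: "\<And>k. s k \<ge>\<^sub>q 0" and t: "\<And>k. t k \<ge>\<^sub>q 0"
    and st: "\<And>k. s k * s (Suc k) - t (Suc k) \<ge>\<^sub>q 0"
    and uv: "\<And>i j. i < j \<Longrightarrow> row_minor u v i j \<ge>\<^sub>q 0"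
    and "k < l"
  shows "row_minor (tridiag_step s t u) (tridiag_step s t v) k l \<ge>\<^sub>q 0"
proof -
  \<comment> \<open>Shifting by one column, with a zero in front, makes the case \<open>k = 0\<close> uniform with the others.\<close>
  define U where "U = case_nat 0 u"
  define V where "V = case_nat 0 v"
  define W where "W = row_minor U V"
  have step_u: "tridiag_step s t u i = U i + s i * U (i+1) + t (i+1) * U (i+2)" for i
    by (cases i) (auto simp: tridiag_step_def U_def)
  have step_v: "tridiag_step s t v i = V i + s i * V (i+1) + t (i+1) * V (i+2)" for i
    by (cases i) (auto simp: tridiag_step_def V_def)
  have W: "W i j \<ge>\<^sub>q 0" if "i \<le> j" for i j
  proof (cases "i = j")
    case True
    then show ?thesis by (simp add: W_def row_minor_def)
  next
    case False
    with that obtain j' where j: "j = Suc j'" by (cases j) auto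
    show ?thesis
    proof (cases i)
      case 0
      then show ?thesis by (simp add: W_def row_minor_def U_def V_def)
    next
      case (Suc i')
      with False that j have "i' < j'" by simp
      from uv[OF this] show ?thesis
        by (simp add: W_def row_minor_def U_def V_def Suc j)
    qed
  qed
  show ?thesis
  proof (cases "l = k + 1")
    case True
    have "row_minor (tridiag_step s t u) (tridiag_step s t v) k l =
      W k (k+1) + s (k+1) * W k (k+2) + t (k+2) * W k (k+3)
      + (s k * s (Suc k) - t (Suc k)) * W (k+1) (k+2) + s k * t (k+2) * W (k+1) (k+3)
      + t (k+1) * t (k+2) * W (k+2) (k+3)"
      unfolding row_minor_def step_u step_v W_def True
      by (simp add: algebra_simps eval_nat_numeral)
    also have "\<dots> \<ge>\<^sub>q 0"
      by (intro q_ge_0_add q_ge_0_mult s t st W) auto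
    finally show ?thesis .
  next
    case False
    with \<open>k < l\<close> have l: "k + 2 \<le> l" by simp
    have "row_minor (tridiag_step s t u) (tridiag_step s t v) k l =
      W k l + s l * W k (l+1) + t (l+1) * W k (l+2)
      + s k * W (k+1) l + s k * s l * W (k+1) (l+1) + s k * t (l+1) * W (k+1) (l+2)
      + t (k+1) * W (k+2) l + t (k+1) * s l * W (k+2) (l+1)
      + t (k+1) * t (l+1) * W (k+2) (l+2)"
      unfolding row_minor_def step_u step_v W_def
      by (simp add: algebra_simps)
    also have "\<dots> \<ge>\<^sub>q 0"
      using l by (intro q_ge_0_add q_ge_0_mult s t W) auto
    finally show ?thesis .
  qed
qed

definition tableau ::
    "(nat \<Rightarrow> 'a::comm_ring_1) \<Rightarrow> (nat \<Rightarrow> 'a) \<Rightarrow> nat \<Rightarrow> nat \<Rightarrow> 'a" where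
  "tableau s t n = (tridiag_step s t ^^ n) (\<lambda>k. if k = 0 then 1 else 0)"

lemma tableau_0: "tableau s t 0 = (\<lambda>k. if k = 0 then 1 else 0)"
  by (simp add: tableau_def)

lemma tableau_Suc: "tableau s t (Suc n) = tridiag_step s t (tableau s t n)"
  by (simp add: tableau_def)

lemma tableau_nonneg:
  assumes s: "\<And>k. s k \<ge>\<^sub>q 0" and t: "\<And>k. t k \<ge>\<^sub>q 0"
  shows "tableau s t n k \<ge>\<^sub>q 0"
proof (induction n arbitrary: k)
  case 0
  then show ?case by (simp add: tableau_0 q_ge_0_iff)
next
  case (Suc n)
  then show ?case
    by (auto simp: tableau_Suc tridiag_step_def split: nat.split
        intro!: q_ge_0_add q_ge_0_mult s t)
qed

text \<open>
  The induction moves both rows downwards together, keeping their distance \<open>d\<close>. Its base case uses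
  the fact that row 0 is a unit vector, so that the minors with column 0 are entries of row \<open>d\<close> and all
  others vanish.
\<close>
lemma tableau_row_minor_nonneg:
  assumes s: "\<And>k. s k \<ge>\<^sub>q 0" and t: "\<And>k. t k \<ge>\<^sub>q 0"
    and st: "\<And>k. s k * s (Suc k) - t (Suc k) \<ge>\<^sub>q 0"
    and "k < l"
  shows "row_minor (tableau s t a) (tableau s t (a + d)) k l \<ge>\<^sub>q 0"
  using \<open>k < l\<close>
proof (induction a arbitrary: k l)
  case 0
  then show ?case
    using tableau_nonneg[where s = s and t = t, OF s t] by (simp add: row_minor_def tableau_0)
next
  case (Suc a)
  show ?case
    unfolding add_Suc tableau_Suc
    by (rule row_minor_tridiag_step_nonneg[where s = s and t = t, OF s t st Suc.IH Suc.prems])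
qed

text \<open>
  Expanding row \<open>m\<close> and row \<open>n + 1\<close> in column 0 once cancels the terms with \<open>s\<^sub>0\<close> and leaves
  \<open>t\<^sub>1\<close> times a minor of the rows \<open>m - 1\<close> and \<open>n\<close>.
\<close>
theorem tableau_strongly_q_log_convex:
  assumes s: "\<And>k. s k \<ge>\<^sub>q 0" and t: "\<And>k. t k \<ge>\<^sub>q 0"
    and st: "\<And>k. s k * s (Suc k) - t (Suc k) \<ge>\<^sub>q 0"
  shows "strongly_q_log_convex (\<lambda>n. tableau s t n 0)"
  unfolding strongly_q_log_convex_def
proof (intro allI impI)
  fix m n :: nat
  assume mn: "1 \<le> m \<and> m \<le> n"
  then obtain a where m: "m = Suc a" by (cases m) auto
  define d where "d = n - a"
  have n: "n = a + d" using mn m by (simp add: d_def)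
  have "tableau s t (m - 1) 0 * tableau s t (n + 1) 0 - tableau s t m 0 * tableau s t n 0
        = t 1 * row_minor (tableau s t a) (tableau s t (a + d)) 0 1"
    by (simp add: m n tableau_Suc tridiag_step_def row_minor_def algebra_simps)
  also have "\<dots> \<ge>\<^sub>q 0"
    by (intro q_ge_0_mult t tableau_row_minor_nonneg[where s = s and t = t, OF s t st]) auto
  finally show "tableau s t (m - 1) 0 * tableau s t (n + 1) 0 \<ge>\<^sub>q
                tableau s t m 0 * tableau s t n 0"
    by (subst q_ge_diff_iff)
qed

section \<open>The triangle of the Eulerian polynomials\<close>

abbreviation q :: "real poly" where
  "q \<equiv> monom 1 1"

definition euler_s :: "nat \<Rightarrow> real poly" where
  "euler_s k = of_nat (k + 1) + of_nat k * q"

definition euler_t :: "nat \<Rightarrow> real poly" where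
  "euler_t k = of_nat (k\<^sup>2) * q"

text \<open>
  Let \<open>f\<close> be the exponential generating function of the first column. The column \<open>k\<close> then has the
  generating function \<open>f (f - 1)\<^sup>k / k!\<close>, and the derivation
  \<open>(1 - q) \<partial>/\<partial>q + x \<partial>/\<partial>x\<close> sends \<open>f\<close> to \<open>f (f - 1)\<close>. Applying it to \<open>f (f - 1)\<^sup>k / k!\<close> gives
  the identity below, which then has a direct proof by induction from the row recurrence.
\<close>
lemma euler_tableau_pderiv:
  defines "T \<equiv> tableau euler_s euler_t"
  shows "(1 - q) * pderiv (T n k) = (of_nat k - of_nat n) * T n k + (of_nat (k + 1))\<^sup>2 * T n (k + 1)"
proof (induction n arbitrary: k)
  case 0
  then show ?case by (simp add: T_def tableau_0)
next
  case (Suc n)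
  define L where "L = (case k of 0 \<Rightarrow> 0 | Suc j \<Rightarrow> T n j)"
  have T_Suc: "T (Suc n) i = (case i of 0 \<Rightarrow> 0 | Suc j \<Rightarrow> T n j)
      + (of_nat (i+1) + of_nat i * q) * T n i + of_nat ((i+1)\<^sup>2) * q * T n (i+1)" for i
    unfolding T_def tableau_Suc tridiag_step_def euler_s_def euler_t_def by simp
  have dq: "pderiv q = 1"
    by (simp add: pderiv_monom)
  \<comment> \<open>For \<open>k = 0\<close> there is no entry to the left, but the weight \<open>k\<^sup>2\<close> vanishes as well.\<close>
  have L: "(1 - q) * pderiv L = (of_nat k - 1 - of_nat n) * L + of_nat k ^ 2 * T n k"
    using Suc.IH[of "k - 1"] by (cases k) (simp_all add: L_def)
  have "(1 - q) * pderiv (T (Suc n) k) = (1 - q) * pderiv L + (1 - q) * of_nat k * T n k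
      + (of_nat (k+1) + of_nat k * q) * ((1 - q) * pderiv (T n k))
      + (1 - q) * of_nat ((k+1)\<^sup>2) * T n (k+1)
      + of_nat ((k+1)\<^sup>2) * q * ((1 - q) * pderiv (T n (k+1)))"
    unfolding T_Suc L_def[symmetric]
    by (simp only: pderiv_add pderiv_mult pderiv_of_nat dq) (simp add: algebra_simps)
  also have "\<dots> = (of_nat k - of_nat (Suc n)) * T (Suc n) k
      + (of_nat (k + 1))\<^sup>2 * T (Suc n) (k + 1)"
    unfolding L Suc.IH T_Suc L_def[symmetric]
    by (simp add: algebra_simps power2_eq_square)
  finally show ?case .
qed

lemma euler_tableau_recurrence:
  defines "T \<equiv> tableau euler_s euler_t"
  shows "T (Suc n) 0 = (1 + of_nat n * q) * T n 0 + q * (1 - q) * pderiv (T n 0)"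
proof -
  have "T (Suc n) 0 = T n 0 + q * T n 1"
    by (simp add: T_def tableau_Suc tridiag_step_def euler_s_def euler_t_def)
  moreover have "T n 1 = (1 - q) * pderiv (T n 0) + of_nat n * T n 0"
    using euler_tableau_pderiv[of n 0] by (simp add: T_def)
  ultimately show ?thesis by (simp only:) (simp add: algebra_simps)
qed

section \<open>Descents of words and insertion of a maximum\<close>

fun list_des :: "'a::linorder list \<Rightarrow> nat" where
  "list_des (x # y # ys) = (if x > y then 1 else 0) + list_des (y # ys)"
| "list_des _ = 0"

lemma list_des_le: "list_des xs \<le> length xs - 1"
  by (induction xs rule: list_des.induct) auto

lemma list_des_map_upt:
  "list_des (map f [a..<b]) = card {i \<in> {a..<b - 1}. f i > f (i + 1)}"
proof (induction "b - a" arbitrary: a)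
  case 0
  then have e: "{i \<in> {a..<b - 1}. f i > f (i + 1)} = {}" by auto
  show ?case unfolding e using 0 by simp
next
  case (Suc d)
  then have ab: "a < b" by simp
  show ?case
  proof (cases "Suc a < b")
    case False
    then have e: "{i \<in> {a..<b - 1}. f i > f (i + 1)} = {}" and b: "b = Suc a"
      using ab by auto
    show ?thesis unfolding e by (simp add: b)
  next
    case True
    have e: "{i \<in> {a..<b - 1}. f i > f (i + 1)} =
        (if f a > f (a + 1) then {a} else {}) \<union> {i \<in> {Suc a..<b - 1}. f i > f (i + 1)}"
      using True by (auto simp: less_diff_conv elim: le_SucE le_neq_implies_less
        intro: Suc_leI dest: le_antisym)
    have IH: "list_des (map f [Suc a..<b]) = card {i \<in> {Suc a..<b - 1}. f i > f (i + 1)}"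
      using Suc by (intro Suc.hyps) simp
    have "list_des (map f [a..<b]) =
        (if f a > f (a + 1) then 1 else 0) + list_des (map f [Suc a..<b])"
      using True by (simp add: upt_conv_Cons)
    then show ?thesis
      unfolding e IH by (subst card_Un_disjoint) auto
  qed
qed

text \<open>
  Passing to one-line notation loses nothing, because a permutation fixes everything outside
  \<open>{1..n}\<close>. Surjectivity follows from injectivity, as both sides have \<open>n!\<close> elements.
\<close>
lemma bij_betw_permutes_permutations_of_set:
  "bij_betw (\<lambda>\<pi>. map \<pi> [1..<Suc n]) {\<pi>. \<pi> permutes {1..n}} (permutations_of_set {1..n})"
  (is "bij_betw ?f ?A ?B")
proof -
  have set_upt: "set [1..<Suc n] = {1..n}" by auto
  have inj: "inj_on ?f ?A"
  proof (rule inj_onI)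
    fix \<pi> \<sigma> assume p: "\<pi> \<in> ?A" "\<sigma> \<in> ?A" and eq: "?f \<pi> = ?f \<sigma>"
    have "\<pi> i = \<sigma> i" for i
    proof (cases "i \<in> {1..n}")
      case True
      with eq set_upt show ?thesis by (metis map_eq_conv)
    next
      case False
      with p show ?thesis by (simp add: permutes_not_in)
    qed
    then show "\<pi> = \<sigma>" by blast
  qed
  have sub: "?f ` ?A \<subseteq> ?B"
  proof
    fix xs assume "xs \<in> ?f ` ?A"
    then obtain \<pi> where p: "\<pi> permutes {1..n}" and xs: "xs = ?f \<pi>" by blast
    have "set xs = {1..n}"
      using permutes_image[OF p] unfolding xs set_map set_upt .
    moreover have "distinct xs"
      unfolding xs distinct_map using permutes_inj_on[OF p] by simp
    ultimately show "xs \<in> ?B" by (rule permutations_of_setI)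
  qed
  have "card (?f ` ?A) = card ?B"
    unfolding card_image[OF inj] using card_permutations[of "{1..n}" n] by simp
  then have "?f ` ?A = ?B"
    by (intro card_subset_eq sub) simp_all
  with inj show ?thesis by (simp add: bij_betw_def)
qed

lemma eulerian_poly_type_A_list:
  "eulerian_poly_type_A n = (\<Sum>xs\<in>permutations_of_set {1..n}. monom 1 (list_des xs))"
proof -
  have "des n \<pi> = list_des (map \<pi> [1..<Suc n])" for \<pi>
    unfolding list_des_map_upt des_def by simp
  then show ?thesis
    unfolding eulerian_poly_type_A_def
    using sum.reindex_bij_betw[OF bij_betw_permutes_permutations_of_set[of n],
        of "\<lambda>xs. monom (1::real) (list_des xs)"] by simp
qed

text \<open>
  A new maximum placed at the end or inside one of the \<open>d\<close> descents keeps the number of descents;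
  at each of the remaining \<open>length xs - d\<close> positions it creates one new descent.
\<close>
lemma sum_insertions:
  fixes M :: "'a::linorder"
  assumes "\<forall>x\<in>set xs. x < M"
  defines "d \<equiv> list_des xs"
  shows "(\<Sum>p\<le>length xs. monom (1::real) (list_des (take p xs @ M # drop p xs))) =
         of_nat (d + 1) * monom 1 d + of_nat (length xs - d) * monom 1 (d + 1)"
  unfolding d_def using assms(1)
proof (induction xs rule: list_des.induct)
  case (1 x y ys)
  have le: "list_des (y # ys) \<le> length ys" using list_des_le[of "y # ys"] by simp
  \<comment> \<open>The positions of \<open>M\<close> split into the front, the gap between \<open>x\<close> and \<open>y\<close>, and those after \<open>y\<close>; the
    last group \<open>?S\<close> occurs also in the induction hypothesis for \<open>y # ys\<close>.\<close>
  define c where "c = (if x > y then 1 else 0::nat)"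
  define e where "e = list_des (y # ys)"
  let ?S = "\<Sum>p\<le>length ys. monom (1::real) (list_des (y # take p ys @ M # drop p ys))"
  have IH: "monom 1 (1 + e) + ?S = of_nat (e + 1) * monom 1 e + of_nat (Suc (length ys) - e) * monom 1 (e + 1)"
    using 1 by (simp add: sum.atMost_Suc_shift e_def del: sum.atMost_Suc)
  have "(\<Sum>p\<le>length (x # y # ys). monom (1::real) (list_des (take p (x#y#ys) @ M # drop p (x#y#ys))))
    = monom 1 (1 + c + e) + monom 1 (1 + e) + monom 1 c * ?S"
    using 1(2) by (auto simp: sum.atMost_Suc_shift c_def e_def sum_distrib_left mult_monom
        dest: less_asym simp del: sum.atMost_Suc)
  also have "?S = of_nat (e + 1) * monom 1 e + of_nat (Suc (length ys) - e) * monom 1 (e + 1) - monom 1 (1+e)"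
    using IH by (simp add: algebra_simps)
  finally show ?case
    using le
    by (auto simp: c_def e_def algebra_simps mult_monom of_nat_diff)
qed auto

text \<open>
  An arrangement of \<open>insert M A\<close> is determined by the arrangement of \<open>A\<close> that remains after
  deleting \<open>M\<close>, together with the position \<open>p\<close> of \<open>M\<close>.
\<close>
lemma sum_permutations_of_set_insert:
  assumes "M \<notin> A"
  shows "(\<Sum>ys\<in>permutations_of_set (insert M A). f ys) =
    (\<Sum>xs\<in>permutations_of_set A. \<Sum>p\<le>length xs. f (take p xs @ M # drop p xs))"
proof -
  have reinsert: "take (length (takeWhile (\<lambda>y. y \<noteq> M) ys)) (removeAll M ys) @
      M # drop (length (takeWhile (\<lambda>y. y \<noteq> M) ys)) (removeAll M ys) = ys"
    if "M \<in> set ys" "distinct ys" for ys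
    using that by (induction ys) auto
  have "(\<Sum>ys\<in>permutations_of_set (insert M A). f ys) =
      (\<Sum>(xs, p)\<in>Sigma (permutations_of_set A) (\<lambda>xs. {..length xs}).
         f (take p xs @ M # drop p xs))"
  proof (rule sum.reindex_bij_witness[where
        j = "\<lambda>ys. (removeAll M ys, length (takeWhile (\<lambda>y. y \<noteq> M) ys))" and
        i = "\<lambda>(xs, p). take p xs @ M # drop p xs"], goal_cases)
    case (1 ys)
    then show ?case by (simp add: reinsert permutations_of_set_def)
  next
    case (2 ys)
    then have "M \<in> set ys" by (auto simp: permutations_of_set_def)
    then have "length (takeWhile (\<lambda>y. y \<noteq> M) ys) \<le> length (removeAll M ys)"
      by (induction ys) auto
    with 2 show ?case
      using assms by (auto simp: permutations_of_set_def distinct_removeAll)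
  next
    case (3 z)
    then obtain xs p where z: "z = (xs, p)" "xs \<in> permutations_of_set A" "p \<le> length xs"
      by auto
    have M: "M \<notin> set xs" using z assms by (auto dest: permutations_of_setD)
    then have "M \<notin> set (take p xs)" "M \<notin> set (drop p xs)"
      by (auto dest: in_set_takeD in_set_dropD)
    moreover from this have "takeWhile (\<lambda>y. y \<noteq> M) (take p xs @ M # drop p xs) = take p xs"
      by (subst takeWhile_append2) auto
    ultimately show ?case using z(3) by (simp add: z(1))
  next
    case (4 z)
    then obtain xs p where z: "z = (xs, p)" "xs \<in> permutations_of_set A" "p \<le> length xs"
      by auto
    have "set (take p xs @ M # drop p xs) = insert M (set (take p xs @ drop p xs))"
      by (simp only: set_append list.set Un_insert_right)
    then have "set (take p xs @ M # drop p xs) = insert M A"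
      using z(2) unfolding append_take_drop_id by (simp add: permutations_of_set_def)
    moreover have "mset (take p xs @ M # drop p xs) = mset (M # (take p xs @ drop p xs))"
      by (simp del: append_take_drop_id)
    then have "distinct (take p xs @ M # drop p xs) = distinct (M # xs)"
      unfolding append_take_drop_id by (rule mset_eq_imp_distinct_iff)
    ultimately show ?case
      using z(1,2) assms by (simp add: permutations_of_set_def)
  next
    case (5 ys)
    then show ?case by (simp add: reinsert permutations_of_set_def)
  qed
  also have "\<dots> = (\<Sum>xs\<in>permutations_of_set A. \<Sum>p\<le>length xs. f (take p xs @ M # drop p xs))"
    by (rule sum.Sigma[symmetric]) auto
  finally show ?thesis .
qed

lemma eulerian_poly_type_A_Suc:
  "eulerian_poly_type_A (Suc n) = (\<Sum>xs\<in>permutations_of_set {1..n}.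
     of_nat (list_des xs + 1) * monom 1 (list_des xs) +
     of_nat (n - list_des xs) * monom 1 (list_des xs + 1))"
proof -
  have ins: "{1..Suc n} = insert (Suc n) {1..n}" by auto
  show ?thesis
    unfolding eulerian_poly_type_A_list ins
  proof (subst sum_permutations_of_set_insert)
    show "(\<Sum>xs\<in>permutations_of_set {1..n}. \<Sum>p\<le>length xs.
             monom (1::real) (list_des (take p xs @ Suc n # drop p xs))) =
          (\<Sum>xs\<in>permutations_of_set {1..n}.
             of_nat (list_des xs + 1) * monom 1 (list_des xs) +
             of_nat (n - list_des xs) * monom 1 (list_des xs + 1))"
    proof (rule sum.cong[OF refl])
      fix xs assume xs: "xs \<in> permutations_of_set {1..n}"
      then have "\<forall>x\<in>set xs. x < Suc n" by (auto dest: permutations_of_setD(1))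
      moreover have "length xs = n"
        using length_finite_permutations_of_set[OF xs] by simp
      ultimately show "(\<Sum>p\<le>length xs. monom (1::real) (list_des (take p xs @ Suc n # drop p xs))) =
          of_nat (list_des xs + 1) * monom 1 (list_des xs) +
          of_nat (n - list_des xs) * monom 1 (list_des xs + 1)"
        using sum_insertions[of xs "Suc n"] by simp
    qed
  qed auto
qed

text \<open>
  The operator on the right sends \<open>q\<^sup>d\<close> to \<open>(d + 1) q\<^sup>d + (n - d) q\<^sup>d\<^sup>+\<^sup>1\<close>, which is the contribution of
  the insertions into one word with \<open>d\<close> descents.
\<close>
lemma eulerian_poly_type_A_recurrence:
  "eulerian_poly_type_A (Suc n) =
     (1 + of_nat n * q) * eulerian_poly_type_A n + q * (1 - q) * pderiv (eulerian_poly_type_A n)"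
proof -
  have "of_nat (d + 1) * monom 1 d + of_nat (n - d) * monom 1 (d + 1) =
      (1 + of_nat n * q) * monom 1 d + q * (1 - q) * pderiv (monom 1 d)" if "d \<le> n" for d
  proof (cases d)
    case 0
    then show ?thesis by (simp add: pderiv_monom mult_monom flip: monom_0)
  next
    case (Suc e)
    have "pderiv (monom (1::real) d) = of_nat d * monom 1 e"
      by (simp add: pderiv_monom Suc of_nat_monom mult_monom)
    moreover have "monom (1::real) d = q * monom 1 e" "monom (1::real) (d + 1) = q * q * monom 1 e"
      by (simp_all add: Suc mult_monom)
    ultimately show ?thesis
      using that by (simp add: of_nat_diff algebra_simps)
  qed
  moreover have "list_des xs \<le> n" if "xs \<in> permutations_of_set {1..n}" for xs
    using list_des_le[of xs] length_finite_permutations_of_set[OF that] by simp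
  ultimately show ?thesis
    unfolding eulerian_poly_type_A_Suc
    by (simp add: eulerian_poly_type_A_list higher_pderiv_sum[of 1, simplified]
        sum_distrib_left sum.distrib)
qed

section \<open>Log-convexity of the Eulerian polynomials\<close>

lemma eulerian_poly_type_A_eq_tableau:
  "eulerian_poly_type_A n = tableau euler_s euler_t n 0"
  by (induction n)
    (simp_all add: eulerian_poly_type_A_0 tableau_0 eulerian_poly_type_A_recurrence
      euler_tableau_recurrence)

lemma strongly_q_log_convex_eulerian_poly_type_A:
  "strongly_q_log_convex eulerian_poly_type_A"
proof -
  have s: "euler_s k \<ge>\<^sub>q 0" for k
    unfolding euler_s_def by (intro q_ge_0_add q_ge_0_mult q_ge_0_of_nat q_ge_0_monom)
  have t: "euler_t k \<ge>\<^sub>q 0" for k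
    unfolding euler_t_def by (intro q_ge_0_mult q_ge_0_of_nat q_ge_0_monom)
  have st: "euler_s k * euler_s (Suc k) - euler_t (Suc k) \<ge>\<^sub>q 0" for k
  proof -
    have "euler_s k * euler_s (Suc k) - euler_t (Suc k) =
        of_nat ((k+1) * (k+2)) + of_nat (k * (k+2)) * q + of_nat (k * (k+1)) * q * q"
      by (simp add: euler_s_def euler_t_def algebra_simps power2_eq_square)
    also have "\<dots> \<ge>\<^sub>q 0"
      by (intro q_ge_0_add q_ge_0_mult q_ge_0_of_nat q_ge_0_monom)
    finally show ?thesis .
  qed
  show ?thesis
    using tableau_strongly_q_log_convex[where s = euler_s and t = euler_t, OF s t st]
    by (simp flip: eulerian_poly_type_A_eq_tableau)
qed

text \<open>
  A nonempty word of length \<open>n\<close> has at most \<open>n - 1\<close> descents, so at least one insertion creates a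
  new descent. Removing one such term \<open>q\<^sup>d\<^sup>+\<^sup>1\<close> for every word subtracts \<open>q P\<^sub>n\<close>.
\<close>
lemma eulerian_poly_type_A_Suc_ge:
  assumes "n \<ge> 1"
  shows "eulerian_poly_type_A (Suc n) \<ge>\<^sub>q q * eulerian_poly_type_A n"
proof -
  have "eulerian_poly_type_A (Suc n) - q * eulerian_poly_type_A n =
     (\<Sum>xs\<in>permutations_of_set {1..n}.
        of_nat (list_des xs + 1) * monom 1 (list_des xs) +
        of_nat (n - 1 - list_des xs) * monom 1 (list_des xs + 1))"
    unfolding eulerian_poly_type_A_Suc unfolding eulerian_poly_type_A_list
      sum_distrib_left sum_subtractf[symmetric]
  proof (rule sum.cong)
    fix xs assume "xs \<in> permutations_of_set {1..n}"
    then have "n - list_des xs = Suc (n - 1 - list_des xs)"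
      using list_des_le[of xs] length_finite_permutations_of_set[of xs] assms by simp
    then show "of_nat (list_des xs + 1) * monom 1 (list_des xs) +
          of_nat (n - list_des xs) * monom 1 (list_des xs + 1) - q * monom 1 (list_des xs) =
        of_nat (list_des xs + 1) * monom 1 (list_des xs) +
          of_nat (n - 1 - list_des xs) * monom 1 (list_des xs + 1)"
      by (simp add: mult_monom algebra_simps)
  qed simp
  also have "\<dots> \<ge>\<^sub>q 0"
    by (intro q_ge_0_sum q_ge_0_add q_ge_0_mult q_ge_0_of_nat q_ge_0_monom)
  finally show ?thesis by (subst q_ge_diff_iff)
qed

text \<open>
  For \<open>m \<ge> 2\<close> the difference is \<open>q\<^sup>2\<close> times that of type A; for \<open>m = 1\<close> it is
  \<open>q (P\<^sub>n\<^sub>+\<^sub>1 - q P\<^sub>n)\<close>, because \<open>A\<^sub>0 = 1\<close> lacks the factor \<open>q\<close>.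
\<close>
lemma strongly_q_log_convex_eulerian_poly: "strongly_q_log_convex eulerian_poly"
  unfolding strongly_q_log_convex_def
proof (intro allI impI)
  fix m n :: nat
  assume mn: "1 \<le> m \<and> m \<le> n"
  let ?P = eulerian_poly_type_A
  have "eulerian_poly (m - 1) * eulerian_poly (n + 1) - eulerian_poly m * eulerian_poly n \<ge>\<^sub>q 0"
  proof (cases "m = 1")
    case True
    have "?P 1 = 1"
      by (simp add: eulerian_poly_type_A_recurrence eulerian_poly_type_A_0)
    then have "eulerian_poly (m - 1) * eulerian_poly (n + 1) - eulerian_poly m * eulerian_poly n
        = q * (?P (Suc n) - q * ?P n)"
      using True mn by (simp add: eulerian_poly_def algebra_simps)
    moreover have "?P (Suc n) - q * ?P n \<ge>\<^sub>q 0"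
      using eulerian_poly_type_A_Suc_ge mn by (simp flip: q_ge_diff_iff)
    ultimately show ?thesis by (metis q_ge_0_mult q_ge_0_monom)
  next
    case False
    then have "eulerian_poly (m - 1) * eulerian_poly (n + 1) - eulerian_poly m * eulerian_poly n
        = q * q * (?P (m - 1) * ?P (n + 1) - ?P m * ?P n)"
      using mn by (simp add: eulerian_poly_def algebra_simps)
    moreover have "?P (m - 1) * ?P (n + 1) - ?P m * ?P n \<ge>\<^sub>q 0"
      using strongly_q_log_convex_eulerian_poly_type_A mn
      unfolding strongly_q_log_convex_def by (simp flip: q_ge_diff_iff)
    ultimately show ?thesis by (metis q_ge_0_mult q_ge_0_monom)
  qed
  then show "eulerian_poly (m - 1) * eulerian_poly (n + 1) \<ge>\<^sub>q eulerian_poly m * eulerian_poly n"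
    by (subst q_ge_diff_iff)
qed

theorem proposition3p1:
  shows "strongly_q_log_convex eulerian_poly_type_A \<and> strongly_q_log_convex eulerian_poly"
  using strongly_q_log_convex_eulerian_poly_type_A strongly_q_log_convex_eulerian_poly by blast

end
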